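(* Let $0<q\le1$, $\sigma>0$, $C>0$, let $T_b\ge1$ be the number of iterations per epoch, and let $T_0\ge 0$, $T\ge T_0+1$ be integers. Under any privacy accountant for compositions of Sampled Gaussian Mechanisms (SGMs), the algorithm SPARTA run for $T$ epochs in total ($T_0$ epochs of DP-SGD, one epoch of mask selection, $T-T_0-1$ epochs of sparse DP-SGD) has the same privacy guarantees as $T$ epochs of DP-SGD with the same $q,\sigma,C$. That is, for every pair $(\varepsilon,\delta)$ that the accountant certifies for the adaptive composition of $T\,T_b$ SGMs with sampling rate $q$ and noise parameter $\sigma$ (which is the guarantee it gives for $T$ epochs of DP-SGD), SPARTA, viewed as a randomized algorithm of the dataset that outputs its mask $\hat m$ and its final weights, is $(\varepsilon,\delta)$-differentially private.
   Context: Data and losses. Data points are indexed by $[n]=\{1,\dots,n\}$, with differentiable losses $\mathcal{L}_i:\mathbb{R}^d\to\mathbb{R}$. A dataset is a subset $\mathcal{D}\subseteq[n]$; two datasets are neighboring (adjacent) if one is obtained from the other by adding or removing a single element. The constant $n$, the initial (pre-trained, public) weights and all hyperparameters are fixed independently of the dataset. Differential privacy. A randomized algorithm $\mathcal{A}$ is $(\varepsilon,\delta)$-DP if $\mathbb{P}(\mathcal{A}(\mathcal{D})\in K)\le e^{\varepsilon}\,\mathbb{P}(\mathcal{A}(\mathcal{D}')\in K)+\delta$ for every measurable set $K$ of outputs and all neighboring $\mathcal{D},\mathcal{D}'$. SGM. Let $f$ map subsets of $[n]$ to $\mathbb{R}^d$ with $\|f(S)-f(S')\|_2\le C$ for all adjacent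 $S,S'\subseteq[n]$. The SGM with sampling rate $q$ and noise parameter $\sigma$ forms a random $B\subseteq\mathcal{D}$ by including each element of $\mathcal{D}$ independently with probability $q$, and outputs $f(B)+\mathcal{N}(0,C^2\sigma^2I_d)$ with independent noise. Accountant. An accountant for SGMs is a procedure that, given $q$, $\sigma$ and a number of steps $N$, certifies pairs $(\varepsilon,\delta)$ such that every adaptive composition of $N$ SGMs with sampling rate $q$ and noise parameter $\sigma$ is $(\varepsilon,\delta)$-DP. Here, in an adaptive composition, the function $f$ used at each step may depend (measurably) on the outputs of the previous steps, fresh subsampling and noise are used at every step, and all step outputs are released. DP-SGD. One iteration of DP-SGD on a differentiable per-sample objective $\ell_i$ at weights $W^t$: sample $B_t\subseteq\mathcal{D}$ including each point independently with probability $q$; with $g^{t,i}=\nabla\ell_i(W^t)$, form $$\tilde g^t=\frac1{qn}\Big(\sum_{i\in B_t}\frac{g^{t,i}}{\max\{1,\|g^{t,i}\|_2/C\}}+\mathcal{N}(0,\sigma^2C^2I_d)\Big),$$ and set $W^{t+1}=W^t-\eta_t\tilde g^t$, with fixed learning rates $\eta_t>0$. One epoch consists of $T_b$ iterations. SPARTA. The weight indices $[d]$ are partitioned into fixed, data-independent groups $\mathcal{G}_1,\dots,\mathcal{G}_p$, and $k$ is a fixed budget on the number of trainable groups. (1) Starting from the pre-trained weights, run $T_0$ epochs of DP-SGD with $\ell_i=\mathcal{L}_i$; call the resulting weights $W_{\text{old}}$. (2) Mask selection, one epoch: set $\tilde u=0$; for each of $T_b$ freshly sampled batches $B_t$ (each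 point of $\mathcal{D}$ included independently with probability $q$), with $g^{t,i}=\nabla\mathcal{L}_i(W_{\text{old}})$, update $$\tilde u\leftarrow\tilde u+\sum_{i\in B_t}\frac{|g^{t,i}|}{\max\{1,\|g^{t,i}\|_2/C\}}+\mathcal{N}(0,C^2\sigma^2I_d),$$ where $|\cdot|$ is the entrywise absolute value. Then set $\tilde v_j=\sum_{i\in\mathcal{G}_j}\tilde u_i$ for $j\in[p]$; let $\hat z\in\{0,1\}^p$ be the indicator of the $k$ coordinates of $\tilde v$ of largest magnitude (ties broken by a fixed rule); and let $\hat m\in\{0,1\}^d$ with $\hat m_i=1$ if and only if $i$ lies in a group $\mathcal{G}_j$ with $\hat z_j=1$. (3) With $\hat m$ fixed, run $T-T_0-1$ epochs of DP-SGD on $W\mapsto\ell_i(W)=\mathcal{L}_i(W_{\text{old}}+\hat m\odot W)$ starting from $W=0$, where $\odot$ is the entrywise product; the final weights are $W_{\text{old}}+\hat m\odot W$. All three phases use the same $q,\sigma,C$. *)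

theory Defs
  imports "HOL-Probability.Probability"
begin

section \<open>Differential privacy\<close>

text \<open>
  Data points are indexed by \<open>{1..n}\<close> and a dataset is a subset of \<open>{1..n}\<close>.
\<close>

definition adjacent :: "nat set \<Rightarrow> nat set \<Rightarrow> bool" where
  "adjacent D D' \<longleftrightarrow> (\<exists>x. x \<notin> D \<and> D' = insert x D) \<or> (\<exists>x. x \<notin> D' \<and> D = insert x D')"

text \<open>
  A randomized algorithm with outputs in the measurable space \<open>M\<close> is a map from datasets to
  probability measures on \<open>M\<close>.  The first conjunct matters because the Giry bind returns an
  arbitrary measure when applied to a non-measurable kernel.
\<close>

definition differentially_private ::
  "nat \<Rightarrow> 'o measure \<Rightarrow> (nat set \<Rightarrow> 'o measure) \<Rightarrow> real \<Rightarrow> real \<Rightarrow> bool" where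
  "differentially_private n M A \<epsilon> \<delta> \<longleftrightarrow>
     (\<forall>D\<subseteq>{1..n}. A D \<in> space (prob_algebra M)) \<and>
     (\<forall>D\<subseteq>{1..n}. \<forall>D'\<subseteq>{1..n}. adjacent D D' \<longrightarrow>
        (\<forall>K\<in>sets M. measure (A D) K \<le> exp \<epsilon> * measure (A D') K + \<delta>))"


section \<open>Sampled Gaussian mechanisms, adaptive compositions and accountants\<close>

definition poisson_sample :: "real \<Rightarrow> nat set \<Rightarrow> nat set pmf" where
  "poisson_sample q D = map_pmf (\<lambda>b. {i\<in>D. b i}) (Pi_pmf D False (\<lambda>_. bernoulli_pmf q))"

text \<open>The distribution \<open>N(0, s\<^sup>2 I)\<close>; the argument \<open>s\<close> is the standard deviation.\<close>

definition gaussian :: "real \<Rightarrow> (real ^ 'd::finite) measure" where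
  "gaussian s = distr (\<Pi>\<^sub>M i\<in>UNIV. density lborel (normal_density 0 s)) borel (\<lambda>x. \<chi> i. x i)"

definition sensitivity_le :: "nat \<Rightarrow> real \<Rightarrow> (nat set \<Rightarrow> real ^ 'd::finite) \<Rightarrow> bool" where
  "sensitivity_le n C f \<longleftrightarrow>
     (\<forall>S\<subseteq>{1..n}. \<forall>S'\<subseteq>{1..n}. adjacent S S' \<longrightarrow> norm (f S - f S') \<le> C)"

definition sgm ::
  "real \<Rightarrow> real \<Rightarrow> real \<Rightarrow> (nat set \<Rightarrow> real ^ 'd::finite) \<Rightarrow> nat set \<Rightarrow> (real ^ 'd) measure" where
  "sgm q \<sigma> C f D = do {
     B \<leftarrow> measure_pmf (poisson_sample q D);
     z \<leftarrow> gaussian (C * \<sigma>);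
     return borel (f B + z)
   }"

text \<open>
  The outputs of the first \<open>t\<close> steps are recorded as a point of \<open>outputs t\<close>, i.e. as a function
  on \<open>{..<t}\<close>.  The query of step \<open>t\<close> is \<open>f t h\<close>, where \<open>h\<close> is the record of the previous
  outputs; each step may have its own sensitivity bound \<open>C t\<close>.
\<close>

abbreviation outputs :: "nat \<Rightarrow> (nat \<Rightarrow> real ^ 'd::finite) measure" where
  "outputs t \<equiv> (\<Pi>\<^sub>M _\<in>{..<t}. borel)"

primrec adaptive_sgm ::
  "real \<Rightarrow> real \<Rightarrow> (nat \<Rightarrow> real) \<Rightarrow> (nat \<Rightarrow> (nat \<Rightarrow> real ^ 'd::finite) \<Rightarrow> nat set \<Rightarrow> real ^ 'd) \<Rightarrow>
   nat \<Rightarrow> nat set \<Rightarrow> (nat \<Rightarrow> real ^ 'd) measure" where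
  "adaptive_sgm q \<sigma> C f 0 D = return (outputs 0) (\<lambda>_. undefined)"
| "adaptive_sgm q \<sigma> C f (Suc t) D = do {
     h \<leftarrow> adaptive_sgm q \<sigma> C f t D;
     y \<leftarrow> sgm q \<sigma> (C t) (f t h) D;
     return (outputs (Suc t)) (h(t := y))
   }"

definition admissible_queries ::
  "nat \<Rightarrow> nat \<Rightarrow> (nat \<Rightarrow> real) \<Rightarrow> (nat \<Rightarrow> (nat \<Rightarrow> real ^ 'd::finite) \<Rightarrow> nat set \<Rightarrow> real ^ 'd) \<Rightarrow> bool" where
  "admissible_queries n N C f \<longleftrightarrow>
     (\<forall>t<N. (\<forall>S\<subseteq>{1..n}. (\<lambda>h. f t h S) \<in> borel_measurable (outputs t)) \<and>
            (\<forall>h\<in>space (outputs t). sensitivity_le n (C t) (f t h)))"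

text \<open>
  \<open>acc q \<sigma> N\<close> is the set of pairs \<open>(\<epsilon>, \<delta>)\<close> that the accountant certifies.  Soundness is only
  demanded for the given number \<open>n\<close> of data points and the given dimension \<open>CARD('d)\<close>, so
  every accountant that is sound for all \<open>n\<close> and all dimensions is included.
\<close>

definition sgm_accountant ::
  "'d::finite itself \<Rightarrow> nat \<Rightarrow> (real \<Rightarrow> real \<Rightarrow> nat \<Rightarrow> (real \<times> real) set) \<Rightarrow> bool" where
  "sgm_accountant _ n acc \<longleftrightarrow>
     (\<forall>q \<sigma> N \<epsilon> \<delta>. 0 < q \<longrightarrow> q \<le> 1 \<longrightarrow> 0 < \<sigma> \<longrightarrow> (\<epsilon>, \<delta>) \<in> acc q \<sigma> N \<longrightarrow>
        (\<forall>C (f :: nat \<Rightarrow> (nat \<Rightarrow> real ^ 'd) \<Rightarrow> nat set \<Rightarrow> real ^ 'd).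
           (\<forall>t<N. 0 < C t) \<longrightarrow> admissible_queries n N C f \<longrightarrow>
           differentially_private n (outputs N) (adaptive_sgm q \<sigma> C f N) \<epsilon> \<delta>))"


section \<open>DP-SGD\<close>

definition grad :: "(real ^ 'd::finite \<Rightarrow> real) \<Rightarrow> real ^ 'd \<Rightarrow> real ^ 'd" where
  "grad f x = (THE g. GDERIV f x :> g)"

definition clip_factor :: "real \<Rightarrow> real ^ 'd::finite \<Rightarrow> real" where
  "clip_factor C g = max 1 (norm g / C)"

definition dpsgd_step ::
  "nat \<Rightarrow> real \<Rightarrow> real \<Rightarrow> real \<Rightarrow> (nat \<Rightarrow> real ^ 'd::finite \<Rightarrow> real) \<Rightarrow> nat set \<Rightarrow>
   real \<Rightarrow> real ^ 'd \<Rightarrow> (real ^ 'd) measure" where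
  "dpsgd_step n q \<sigma> C l D \<eta> W = do {
     B \<leftarrow> measure_pmf (poisson_sample q D);
     z \<leftarrow> gaussian (C * \<sigma>);
     let g = (1 / (q * real n)) *\<^sub>R ((\<Sum>i\<in>B. grad (l i) W /\<^sub>R clip_factor C (grad (l i) W)) + z);
     return borel (W - \<eta> *\<^sub>R g)
   }"

primrec dpsgd ::
  "nat \<Rightarrow> real \<Rightarrow> real \<Rightarrow> real \<Rightarrow> (nat \<Rightarrow> real ^ 'd::finite \<Rightarrow> real) \<Rightarrow> (nat \<Rightarrow> real) \<Rightarrow> real ^ 'd \<Rightarrow>
   nat \<Rightarrow> nat set \<Rightarrow> (real ^ 'd) measure" where
  "dpsgd n q \<sigma> C l \<eta> W0 0 D = return borel W0"
| "dpsgd n q \<sigma> C l \<eta> W0 (Suc t) D = do {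
     W \<leftarrow> dpsgd n q \<sigma> C l \<eta> W0 t D;
     dpsgd_step n q \<sigma> C l D (\<eta> t) W
   }"


section \<open>SPARTA\<close>

primrec mask_scores ::
  "real \<Rightarrow> real \<Rightarrow> real \<Rightarrow> (nat \<Rightarrow> real ^ 'd::finite \<Rightarrow> real) \<Rightarrow> real ^ 'd \<Rightarrow>
   nat \<Rightarrow> nat set \<Rightarrow> (real ^ 'd) measure" where
  "mask_scores q \<sigma> C L W 0 D = return borel 0"
| "mask_scores q \<sigma> C L W (Suc t) D = do {
     u \<leftarrow> mask_scores q \<sigma> C L W t D;
     B \<leftarrow> measure_pmf (poisson_sample q D);
     z \<leftarrow> gaussian (C * \<sigma>);
     return borel (u + ((\<Sum>i\<in>B. (\<chi> a. \<bar>grad (L i) W $ a\<bar>) /\<^sub>R clip_factor C (grad (L i) W)) + z))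
   }"

text \<open>The groups are indexed by the finite type \<open>'p\<close>.\<close>

definition group_scores :: "('p::finite \<Rightarrow> 'd::finite set) \<Rightarrow> real ^ 'd \<Rightarrow> real ^ 'p" where
  "group_scores G u = (\<chi> j. \<Sum>i\<in>G j. u $ i)"

text \<open>
  A rule mapping a vector to the indicator of \<open>k\<close> of its coordinates of largest magnitude.
  Any fixed way of breaking ties is allowed, as long as the rule is Borel measurable.
\<close>

definition top_k_rule :: "nat \<Rightarrow> (real ^ 'p::finite \<Rightarrow> real ^ 'p) \<Rightarrow> bool" where
  "top_k_rule k top_k \<longleftrightarrow> top_k \<in> borel_measurable borel \<and>
     (\<forall>v. (\<forall>j. top_k v $ j \<in> {0, 1}) \<and> card {j. top_k v $ j = 1} = k \<and>
          (\<forall>i j. top_k v $ i = 1 \<longrightarrow> top_k v $ j = 0 \<longrightarrow> \<bar>v $ j\<bar> \<le> \<bar>v $ i\<bar>))"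

definition weight_mask :: "('p::finite \<Rightarrow> 'd::finite set) \<Rightarrow> real ^ 'p \<Rightarrow> real ^ 'd" where
  "weight_mask G z = (\<chi> i. if \<exists>j. i \<in> G j \<and> z $ j = 1 then 1 else 0)"

text \<open>
  \<open>\<eta>\<^sub>1\<close> and \<open>\<eta>\<^sub>3\<close> are the learning rates of the first and the last phase.  Multiplication of vectors
  is entrywise.
\<close>

definition sparta ::
  "nat \<Rightarrow> real \<Rightarrow> real \<Rightarrow> real \<Rightarrow> (nat \<Rightarrow> real ^ 'd::finite \<Rightarrow> real) \<Rightarrow>
   (nat \<Rightarrow> real) \<Rightarrow> (nat \<Rightarrow> real) \<Rightarrow> ('p::finite \<Rightarrow> 'd set) \<Rightarrow> (real ^ 'p \<Rightarrow> real ^ 'p) \<Rightarrow> real ^ 'd \<Rightarrow>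
   nat \<Rightarrow> nat \<Rightarrow> nat \<Rightarrow> nat set \<Rightarrow> ((real ^ 'd) \<times> (real ^ 'd)) measure" where
  "sparta n q \<sigma> C L \<eta>\<^sub>1 \<eta>\<^sub>3 G top_k W0 Tb T0 T D = do {
     Wold \<leftarrow> dpsgd n q \<sigma> C L \<eta>\<^sub>1 W0 (T0 * Tb) D;
     u \<leftarrow> mask_scores q \<sigma> C L Wold Tb D;
     let m = weight_mask G (top_k (group_scores G u));
     W \<leftarrow> dpsgd n q \<sigma> C (\<lambda>i W. L i (Wold + m * W)) \<eta>\<^sub>3 0 ((T - T0 - 1) * Tb) D;
     return borel (m, Wold + m * W)
   }"

end

theory Submission
  imports Defs
begin

text \<open>
  SPARTA is a deterministic state machine fed with the outputs of sampled Gaussian mechanisms: its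
  state is a triple of the pre-mask weights, the accumulated scores and the sparse weights, and
  every iteration queries a sum of clipped vectors that depends on the data and the current state
  only.  Entrywise absolute values preserve the norm used for clipping, so the mask selection
  queries have the same sensitivity \<open>C\<close> as those of DP-SGD.  Since the state is a function of the
  released outputs, SPARTA is a measurable post-processing of an adaptive composition of \<open>T * Tb\<close>
  mechanisms.  Measurability of the queries holds because the gradient of an everywhere
  differentiable function is a pointwise limit of continuous difference quotients.
\<close>

section \<open>Borel measurability of vector-valued maps\<close>

lemma borel_measurable_vec:
  fixes f :: "'a \<Rightarrow> real ^ 'd::finite"
  assumes "\<And>i. (\<lambda>x. f x $ i) \<in> borel_measurable M"
  shows "f \<in> borel_measurable M"
proof (rule borel_measurable_euclidean_space[THEN iffD2], rule ballI)
  fix b :: "real ^ 'd" assume "b \<in> Basis"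
  then obtain i where "b = axis i 1"
    by (auto simp: Basis_vec_def)
  then show "(\<lambda>x. f x \<bullet> b) \<in> borel_measurable M"
    using assms[of i] by (simp only: inner_axis inner_real_def mult_1_right)
qed

lemma borel_measurable_vec_mult:
  fixes f g :: "'a \<Rightarrow> real ^ 'd::finite"
  assumes f: "f \<in> borel_measurable M" and g: "g \<in> borel_measurable M"
  shows "(\<lambda>x. f x * g x) \<in> borel_measurable M"
proof (rule borel_measurable_vec)
  fix i
  show "(\<lambda>x. (f x * g x) $ i) \<in> borel_measurable M"
    unfolding vector_mult_component
    by (intro borel_measurable_times measurable_compose[OF f borel_measurable_nth]
        measurable_compose[OF g borel_measurable_nth])
qed

lemma borel_measurable_fst: "fst \<in> borel_measurable borel"
  by (intro borel_measurable_continuous_onI continuous_intros)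

lemma borel_measurable_snd: "snd \<in> borel_measurable borel"
  by (intro borel_measurable_continuous_onI continuous_intros)

text \<open>Absorbs a deterministic re-encoding \<open>e\<close> into the kernel that follows it:
  associativity of bind, then the left unit law at each point.\<close>

lemma bind_return_bind:
  assumes e: "e \<in> M \<rightarrow>\<^sub>M N" and K: "K \<in> N \<rightarrow>\<^sub>M subprob_algebra R"
  shows "M \<bind> (\<lambda>x. return N (e x)) \<bind> K = M \<bind> (\<lambda>x. K (e x))"
proof -
  have "M \<bind> (\<lambda>x. return N (e x)) \<bind> K = M \<bind> (\<lambda>x. return N (e x) \<bind> K)"
    by (rule bind_assoc[OF measurable_compose[OF e return_measurable] K])
  also have "\<dots> = M \<bind> (\<lambda>x. K (e x))"
    by (intro bind_cong refl bind_return[OF K] measurable_space[OF e])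
  finally show ?thesis .
qed

section \<open>Gaussian noise and sampled Gaussian mechanisms as kernels\<close>

lemma sets_gaussian [simp, measurable_cong]: "sets (gaussian s) = sets borel"
  by (simp add: gaussian_def)

lemma gaussian_in_prob_algebra:
  assumes "0 < s"
  shows "(gaussian s :: (real ^ 'd::finite) measure) \<in> space (prob_algebra borel)"
proof -
  have P: "prob_space (\<Pi>\<^sub>M i\<in>(UNIV::'d set). density lborel (normal_density 0 s))"
    by (intro prob_space_PiM prob_space_normal_density assms)
  have "(\<lambda>x. \<chi> i. x i) \<in>
      (\<Pi>\<^sub>M i\<in>(UNIV::'d set). density lborel (normal_density 0 s)) \<rightarrow>\<^sub>M (borel :: (real ^ 'd) measure)"
    (is "_ \<in> ?P \<rightarrow>\<^sub>M _")
  proof (rule borel_measurable_vec)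
    fix i :: 'd
    have "(\<lambda>x. x i) \<in> ?P \<rightarrow>\<^sub>M density lborel (normal_density 0 s)"
      by (rule measurable_component_singleton) simp
    moreover have "(\<lambda>x. x) \<in> density lborel (normal_density 0 s) \<rightarrow>\<^sub>M borel"
      by simp
    ultimately have "(\<lambda>x. x i) \<in> ?P \<rightarrow>\<^sub>M borel"
      by (rule measurable_compose)
    then show "(\<lambda>x. (\<chi> i. x i) $ i) \<in> borel_measurable ?P"
      by (simp only: vec_lambda_beta)
  qed
  from prob_space.prob_space_distr[OF P this] show ?thesis
    by (simp only: gaussian_def space_prob_algebra sets_distr mem_Collect_eq simp_thms)
qed

lemma set_poisson_sample:
  assumes "B \<in> set_pmf (poisson_sample q D)"
  shows "B \<subseteq> D"
  using assms by (auto simp: poisson_sample_def)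

lemma measurable_bind_measure_pmf:
  assumes "finite (set_pmf p)"
    and K0: "\<And>x B. x \<in> space M \<Longrightarrow> K x B \<in> space (prob_algebra N)"
    and K: "\<And>B. B \<in> set_pmf p \<Longrightarrow> (\<lambda>x. K x B) \<in> M \<rightarrow>\<^sub>M prob_algebra N"
  shows "(\<lambda>x. measure_pmf p \<bind> K x) \<in> M \<rightarrow>\<^sub>M prob_algebra N"
proof -
  obtain B0 where B0: "B0 \<in> set_pmf p"
    using set_pmf_not_empty[of p] by blast
  \<comment> \<open>There may be uncountably many \<open>B\<close>, and \<open>K x B\<close> need not be measurable in \<open>x\<close> for \<open>B\<close>
    outside the support.  Redirecting these \<open>B\<close> into the finite support makes \<open>K\<close> jointly measurable.\<close>
  define r where "r B = (if B \<in> set_pmf p then B else B0)" for B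
  have r: "r B \<in> set_pmf p" for B
    using B0 by (simp add: r_def)
  have "(\<lambda>(x, B). K x (r B)) \<in> M \<Otimes>\<^sub>M measure_pmf p \<rightarrow>\<^sub>M prob_algebra N"
  proof -
    have "(\<lambda>z. (\<lambda>B z. K (fst z) B) (r (snd z)) z) \<in> M \<Otimes>\<^sub>M measure_pmf p \<rightarrow>\<^sub>M prob_algebra N"
    proof (rule measurable_compose_countable'[where I = "set_pmf p"])
      show "(\<lambda>z. K (fst z) B) \<in> M \<Otimes>\<^sub>M measure_pmf p \<rightarrow>\<^sub>M prob_algebra N" if "B \<in> set_pmf p" for B
        using measurable_compose[OF measurable_fst K[OF that]] .
      have "r \<in> measure_pmf p \<rightarrow>\<^sub>M count_space (set_pmf p)"
        using r by (simp only: measurable_pmf_measure1 space_count_space) blast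
      from measurable_compose[OF measurable_snd this]
      show "(\<lambda>z. r (snd z)) \<in> M \<Otimes>\<^sub>M measure_pmf p \<rightarrow>\<^sub>M count_space (set_pmf p)" .
    qed simp
    then show ?thesis
      by (simp add: case_prod_beta')
  qed
  moreover have "(\<lambda>x. measure_pmf p) \<in> M \<rightarrow>\<^sub>M prob_algebra (measure_pmf p)"
    by (intro measurable_const) (simp add: space_prob_algebra measure_pmf.prob_space_axioms)
  ultimately have "(\<lambda>x. measure_pmf p \<bind> (\<lambda>B. K x (r B))) \<in> M \<rightarrow>\<^sub>M prob_algebra N"
    by (intro measurable_bind_prob_space2)
  moreover have "measure_pmf p \<bind> K x = measure_pmf p \<bind> (\<lambda>B. K x (r B))"
    if "x \<in> space M" for x
    using K0[OF that]
    by (intro bind_measure_pmf_cong) (auto simp: r_def space_prob_algebra space_subprob_algebra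
        prob_space_imp_subprob_space)
  ultimately show ?thesis
    by (subst measurable_cong) auto
qed

lemma measurable_gaussian_shift:
  assumes "0 < s"
  shows "(\<lambda>v :: real ^ 'd::finite. gaussian s \<bind> (\<lambda>z. return borel (v + z))) \<in> borel \<rightarrow>\<^sub>M prob_algebra borel"
  using gaussian_in_prob_algebra[OF assms, where 'd = 'd]
  by (intro measurable_bind_prob_space2[where N = borel] measurable_const) (simp_all, measurable)

lemma gaussian_shift_in_prob_algebra:
  assumes "0 < s"
  shows "gaussian s \<bind> (\<lambda>z. return borel (v + z)) \<in> space (prob_algebra (borel :: (real ^ 'd::finite) measure))"
  using measurable_space[OF measurable_gaussian_shift[OF assms], of v] by simp

text \<open>Measurability in \<open>s\<close> is demanded only for \<open>B \<subseteq> D\<close>,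
  the batches that can be sampled: losses of indices outside the data are arbitrary, so queries on
  other sets need not be measurable.\<close>

lemma measurable_sgm:
  fixes F :: "'s \<Rightarrow> nat set \<Rightarrow> real ^ 'd::finite"
  assumes "finite D" and "0 < C * \<sigma>"
    and F: "\<And>B. B \<subseteq> D \<Longrightarrow> (\<lambda>s. F s B) \<in> borel_measurable M"
  shows "(\<lambda>s. sgm q \<sigma> C (F s) D) \<in> M \<rightarrow>\<^sub>M prob_algebra borel"
  unfolding sgm_def
proof (rule measurable_bind_measure_pmf)
  show "gaussian (C * \<sigma>) \<bind> (\<lambda>z. return borel (F s B + z)) \<in> space (prob_algebra borel)" for s B
    using assms(2) by (rule gaussian_shift_in_prob_algebra)
  show "finite (set_pmf (poisson_sample q D))"
    by (rule finite_subset[of _ "Pow D"]) (use set_poisson_sample \<open>finite D\<close> in auto)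
  show "(\<lambda>s. gaussian (C * \<sigma>) \<bind> (\<lambda>z. return borel (F s B + z))) \<in> M \<rightarrow>\<^sub>M prob_algebra borel"
    if "B \<in> set_pmf (poisson_sample q D)" for B
    using measurable_compose[OF F[OF set_poisson_sample[OF that]] measurable_gaussian_shift[OF assms(2)]] .
qed

lemma sgm_in_prob_algebra:
  fixes f :: "nat set \<Rightarrow> real ^ 'd::finite"
  assumes "finite D" and "0 < C * \<sigma>"
  shows "sgm q \<sigma> C f D \<in> space (prob_algebra borel)"
  \<comment> \<open>A fixed query is a constant kernel on the one-point space.\<close>
  using measurable_space[OF measurable_sgm[OF assms, of "\<lambda>_::unit. f" "count_space UNIV"], of "()"]
  by simp

lemma sets_sgm:
  fixes f :: "nat set \<Rightarrow> real ^ 'd::finite"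
  assumes "finite D" and "0 < C * \<sigma>"
  shows "sets (sgm q \<sigma> C f D) = sets borel"
  using sgm_in_prob_algebra[OF assms, where f = f and q = q] by (simp add: space_prob_algebra)

text \<open>Brings a mechanism followed by a deterministic map into the shape in which
  \<open>dpsgd_step\<close> and \<open>mask_scores\<close> are written: sample, add noise,
  return.\<close>

lemma sgm_bind_return:
  fixes f :: "nat set \<Rightarrow> real ^ 'd::finite"
  assumes s: "0 < C * \<sigma>" and g: "g \<in> borel \<rightarrow>\<^sub>M N"
  shows "sgm q \<sigma> C f D \<bind> (\<lambda>y. return N (g y)) =
    measure_pmf (poisson_sample q D) \<bind> (\<lambda>B. gaussian (C * \<sigma>) \<bind> (\<lambda>z. return N (g (f B + z))))"
proof -
  have R: "(\<lambda>y. return N (g y)) \<in> borel \<rightarrow>\<^sub>M subprob_algebra N"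
    using measurable_compose[OF g return_measurable] .
  have shift: "(\<lambda>z. return borel (v + z)) \<in> gaussian (C * \<sigma>) \<rightarrow>\<^sub>M subprob_algebra borel"
    for v :: "real ^ 'd"
    by measurable
  have "gaussian (C * \<sigma>) \<bind> (\<lambda>z. return borel (f B + z)) \<bind> (\<lambda>y. return N (g y)) =
      gaussian (C * \<sigma>) \<bind> (\<lambda>z. return N (g (f B + z)))" for B
    by (subst bind_assoc[OF shift R]) (simp add: bind_return[OF R])
  \<comment> \<open>The sampling distribution carries the discrete sigma-algebra, so only the values
    of the kernel need checking.\<close>
  moreover have "(\<lambda>B. gaussian (C * \<sigma>) \<bind> (\<lambda>z. return borel (f B + z))) \<in>
      measure_pmf (poisson_sample q D) \<rightarrow>\<^sub>M subprob_algebra borel"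
    using gaussian_shift_in_prob_algebra[OF s, where 'd = 'd]
    by (auto simp: space_prob_algebra space_subprob_algebra prob_space_imp_subprob_space)
  ultimately show ?thesis
    unfolding sgm_def by (subst bind_assoc[OF _ R]) simp_all
qed

section \<open>State machines driven by sampled Gaussian mechanisms\<close>

text \<open>The start state comes last, so a run of \<open>t\<close> steps is a kernel on states and
  runs can be chained by bind. Unlike in \<open>adaptive_sgm\<close>, only the current state is
  kept.\<close>

primrec sgm_process ::
  "real \<Rightarrow> real \<Rightarrow> real \<Rightarrow> (nat \<Rightarrow> 's \<Rightarrow> nat set \<Rightarrow> real ^ 'd::finite) \<Rightarrow>
   (nat \<Rightarrow> 's \<Rightarrow> real ^ 'd \<Rightarrow> 's) \<Rightarrow> nat set \<Rightarrow> nat \<Rightarrow> 's \<Rightarrow> ('s::topological_space) measure" where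
  "sgm_process q \<sigma> C query upd D 0 s = return borel s"
| "sgm_process q \<sigma> C query upd D (Suc t) s = do {
     s' \<leftarrow> sgm_process q \<sigma> C query upd D t s;
     y \<leftarrow> sgm q \<sigma> C (query t s') D;
     return borel (upd t s' y)
   }"

text \<open>Replays the deterministic part of a run from a record of mechanism outputs. It supplies
  the state to the adaptive queries and, at the end, serves as post-processing of the
  record.\<close>

primrec sgm_state :: "(nat \<Rightarrow> 's \<Rightarrow> 'y \<Rightarrow> 's) \<Rightarrow> 's \<Rightarrow> nat \<Rightarrow> (nat \<Rightarrow> 'y) \<Rightarrow> 's" where
  "sgm_state upd s 0 h = s"
| "sgm_state upd s (Suc t) h = upd t (sgm_state upd s t h) (h t)"

lemma sgm_state_fun_upd: "t \<le> i \<Longrightarrow> sgm_state upd s t (h(i := y)) = sgm_state upd s t h"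
  by (induction t) auto

text \<open>The state space is an arbitrary topological space, so joint measurability of
  \<open>upd\<close> refers to the product sigma-algebra, which may be smaller than the Borel
  sigma-algebra of the product space.\<close>

locale sgm_machine =
  fixes q \<sigma> C :: real
    and D :: "nat set"
    and query :: "nat \<Rightarrow> 's::topological_space \<Rightarrow> nat set \<Rightarrow> real ^ 'd::finite"
    and upd :: "nat \<Rightarrow> 's \<Rightarrow> real ^ 'd \<Rightarrow> 's"
  assumes finite_data: "finite D"
    and noise_pos: "0 < C * \<sigma>"
    and query_measurable: "\<And>t B. B \<subseteq> D \<Longrightarrow> (\<lambda>s. query t s B) \<in> borel_measurable borel"
    and upd_measurable: "\<And>t. (\<lambda>(s, y). upd t s y) \<in> borel \<Otimes>\<^sub>M borel \<rightarrow>\<^sub>M borel"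
begin

abbreviation process :: "nat \<Rightarrow> 's \<Rightarrow> 's measure" where
  "process \<equiv> sgm_process q \<sigma> C query upd D"

definition step :: "nat \<Rightarrow> 's \<Rightarrow> 's measure" where
  "step t s = sgm q \<sigma> C (query t s) D \<bind> (\<lambda>y. return borel (upd t s y))"

lemma process_Suc: "process (Suc t) s = process t s \<bind> step t"
  by (simp add: step_def[abs_def])

lemma sgm_query_measurable: "(\<lambda>s. sgm q \<sigma> C (query t s) D) \<in> borel \<rightarrow>\<^sub>M prob_algebra borel"
  using finite_data noise_pos query_measurable by (rule measurable_sgm)

lemma upd_measurable': "upd t s \<in> borel \<rightarrow>\<^sub>M borel"
proof -
  have "(\<lambda>y. (s, y)) \<in> borel \<rightarrow>\<^sub>M borel \<Otimes>\<^sub>M borel"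
    by (rule measurable_Pair1') simp
  from measurable_compose[OF this upd_measurable] show ?thesis
    by simp
qed

lemma step_measurable: "step t \<in> borel \<rightarrow>\<^sub>M prob_algebra borel"
  unfolding step_def[abs_def]
  using measurable_compose[OF upd_measurable measurable_return_prob_space]
  by (intro measurable_bind_prob_space2[OF sgm_query_measurable]) (simp add: case_prod_beta')

lemma process_measurable: "process t \<in> borel \<rightarrow>\<^sub>M prob_algebra borel"
proof (induction t)
  case 0
  then show ?case by simp
next
  case (Suc t)
  show ?case
    unfolding process_Suc[abs_def]
    by (rule measurable_bind_prob_space[OF Suc step_measurable])
qed

lemma process_in_prob_algebra: "process t s \<in> space (prob_algebra borel)"
  using measurable_space[OF process_measurable] by simp

lemma sets_process [simp]: "sets (process t s) = sets borel"
  using process_in_prob_algebra by (simp add: space_prob_algebra)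

lemma step_bind_return:
  assumes [measurable]: "e \<in> borel \<rightarrow>\<^sub>M N"
  shows "step t s \<bind> (\<lambda>s. return N (e s)) =
    sgm q \<sigma> C (query t s) D \<bind> (\<lambda>y. return N (e (upd t s y)))"
proof -
  have e: "(\<lambda>s. return N (e s)) \<in> borel \<rightarrow>\<^sub>M subprob_algebra N"
    by measurable
  have "(\<lambda>y. return borel (upd t s y)) \<in> borel \<rightarrow>\<^sub>M subprob_algebra borel"
    using measurable_compose[OF upd_measurable' return_measurable] .
  moreover have "sets (sgm q \<sigma> C (query t s) D) = sets borel"
    using finite_data noise_pos by (rule sets_sgm)
  ultimately have "(\<lambda>y. return borel (upd t s y)) \<in> sgm q \<sigma> C (query t s) D \<rightarrow>\<^sub>M subprob_algebra borel"
    by (subst measurable_cong_sets[OF _ refl])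
  then show ?thesis
    unfolding step_def by (simp add: bind_assoc[OF _ e] bind_return[OF e])
qed

lemma measurable_process_iff [simp]: "measurable (process t s) N = measurable borel N"
  by (intro measurable_cong_sets) simp_all

text \<open>The Markov property: after \<open>a\<close> steps only the state reached matters, and
  the rest of the run is a machine whose clock is advanced by \<open>a\<close>.\<close>

lemma process_add:
  "process (a + b) s =
    process a s \<bind> sgm_process q \<sigma> C (\<lambda>t. query (a + t)) (\<lambda>t. upd (a + t)) D b"
proof (induction b)
  case 0
  show ?case
    by (simp add: bind_return'')
next
  case (Suc b)
  interpret shift: sgm_machine q \<sigma> C D "\<lambda>t. query (a + t)" "\<lambda>t. upd (a + t)"
    by unfold_locales (simp_all add: finite_data noise_pos query_measurable upd_measurable)
  have "shift.step = (\<lambda>t. step (a + t))"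
    by (simp add: fun_eq_iff step_def shift.step_def)
  have "process (a + Suc b) s = process a s \<bind> shift.process b \<bind> step (a + b)"
    using Suc by (simp only: add_Suc_right process_Suc)
  also have "\<dots> = process a s \<bind> (\<lambda>s'. shift.process b s' \<bind> step (a + b))"
    by (rule bind_assoc[OF _ measurable_prob_algebraD[OF step_measurable]])
      (simp add: measurable_prob_algebraD[OF shift.process_measurable])
  also have "\<dots> = process a s \<bind> shift.process (Suc b)"
    using \<open>shift.step = (\<lambda>t. step (a + t))\<close> by (simp only: shift.process_Suc[abs_def])
  finally show ?case .
qed

text \<open>The map \<open>e\<close> intertwines the two machines: equal queries give equally
  distributed outputs, and updating commutes with \<open>e\<close>. Compatibility is restricted to
  \<open>t < N\<close> because a phase of SPARTA agrees with its stand-alone algorithm only while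
  that phase lasts.\<close>

lemma process_simulation:
  assumes "sgm_machine \<sigma> C D query' upd'"
    and [measurable]: "e \<in> borel \<rightarrow>\<^sub>M borel"
    and query: "\<And>t s. t < N \<Longrightarrow> query' t (e s) = query t s"
    and upd: "\<And>t s y. t < N \<Longrightarrow> upd' t (e s) y = e (upd t s y)"
  shows "sgm_process q \<sigma> C query' upd' D N (e s) = process N s \<bind> (\<lambda>s. return borel (e s))"
  using query upd
proof (induction N)
  case 0
  have e: "(\<lambda>s. return borel (e s)) \<in> borel \<rightarrow>\<^sub>M subprob_algebra borel"
    by measurable
  show ?case
    unfolding sgm_process.simps by (subst bind_return[OF e]) simp_all
next
  case (Suc N)
  interpret M': sgm_machine q \<sigma> C D query' upd' by fact
  have e: "(\<lambda>s. return borel (e s)) \<in> borel \<rightarrow>\<^sub>M subprob_algebra borel"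
    by measurable
  have "M'.process (Suc N) (e s) = process N s \<bind> (\<lambda>s. return borel (e s)) \<bind> M'.step N"
    using Suc by (simp only: M'.process_Suc less_SucI)
  also have "\<dots> = process N s \<bind> (\<lambda>s. M'.step N (e s))"
    using e by (simp add: bind_assoc[OF _ measurable_prob_algebraD[OF M'.step_measurable]]
        bind_return[OF measurable_prob_algebraD[OF M'.step_measurable]])
  also have "\<dots> = process N s \<bind> (\<lambda>s. step N s \<bind> (\<lambda>s. return borel (e s)))"
    using Suc.prems by (simp add: step_bind_return M'.step_def)
  also have "\<dots> = process (Suc N) s \<bind> (\<lambda>s. return borel (e s))"
    unfolding process_Suc
    by (rule bind_assoc[OF _ e, symmetric]) (simp add: measurable_prob_algebraD[OF step_measurable])
  finally show ?case .
qed

section \<open>States recomputed from the released outputs\<close>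

lemma sgm_state_measurable:
  "t \<le> N \<Longrightarrow> sgm_state upd s t \<in> (\<Pi>\<^sub>M _\<in>{..<N}. borel) \<rightarrow>\<^sub>M borel"
proof (induction t)
  case 0
  show ?case by simp
next
  case (Suc t)
  \<comment> \<open>The bound \<open>Suc t \<le> N\<close> makes entry \<open>t\<close> a component
    of the record space.\<close>
  then have "(\<lambda>h. (sgm_state upd s t h, h t)) \<in> (\<Pi>\<^sub>M _\<in>{..<N}. borel) \<rightarrow>\<^sub>M borel \<Otimes>\<^sub>M borel"
    by (intro measurable_Pair) (auto intro!: measurable_component_singleton)
  from measurable_compose[OF this upd_measurable] show ?case
    by simp
qed

lemma adaptive_sgm_in_prob_algebra:
  "adaptive_sgm q \<sigma> (\<lambda>_. C) (\<lambda>t h. query t (sgm_state upd s t h)) t D \<in> space (prob_algebra (outputs t))"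
proof (induction t)
  case 0
  show ?case
    by (simp add: space_prob_algebra prob_space_return space_PiM)
next
  case (Suc t)
  have K: "(\<lambda>h. sgm q \<sigma> C (query t (sgm_state upd s t h)) D) \<in> outputs t \<rightarrow>\<^sub>M prob_algebra borel"
    using measurable_compose[OF sgm_state_measurable sgm_query_measurable] by blast
  \<comment> \<open>With \<open>{..<Suc t}\<close> written as \<open>insert t {..<t}\<close>,
    recording an output extends a product by one coordinate.\<close>
  have upd: "(\<lambda>(h, y). h(t := y)) \<in> outputs t \<Otimes>\<^sub>M borel \<rightarrow>\<^sub>M outputs (Suc t)"
    unfolding lessThan_Suc by measurable
  have "(\<lambda>(h, y). return (outputs (Suc t)) (h(t := y))) \<in> outputs t \<Otimes>\<^sub>M borel \<rightarrow>\<^sub>M prob_algebra (outputs (Suc t))"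
    using measurable_compose[OF upd measurable_return_prob_space] by (simp add: case_prod_beta')
  from measurable_bind_prob_space2[OF K this]
  have "(\<lambda>h. sgm q \<sigma> C (query t (sgm_state upd s t h)) D \<bind> (\<lambda>y. return (outputs (Suc t)) (h(t := y))))
     \<in> outputs t \<rightarrow>\<^sub>M prob_algebra (outputs (Suc t))" .
  \<comment> \<open>The identity on probability measures is itself a kernel, so binding is
    measurable in the measure and can be evaluated at the induction hypothesis.\<close>
  from measurable_space[OF measurable_bind_prob_space[OF measurable_ident this] Suc]
  show ?case by simp
qed

text \<open>The queries of the composition see the replayed state, so both sides draw from the same
  mechanism at each step. The induction trades updating the state for appending the output to the
  record and replaying it.\<close>

lemma process_eq_adaptive_sgm:
  "process t s = adaptive_sgm q \<sigma> (\<lambda>_. C) (\<lambda>t h. query t (sgm_state upd s t h)) t D \<bind>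
     (\<lambda>h. return borel (sgm_state upd s t h))"
  (is "_ = Giry_Monad.bind (?A t) (?R t)")
proof (induction t)
  case 0
  have R: "(\<lambda>h. return borel (sgm_state upd s 0 h)) \<in> outputs 0 \<rightarrow>\<^sub>M subprob_algebra borel"
    using measurable_compose[OF sgm_state_measurable return_measurable] by blast
  show ?case
    unfolding sgm_process.simps(1) adaptive_sgm.simps(1)
    by (subst bind_return[OF R]) (simp_all add: space_PiM)
next
  case (Suc t)
  define K where "K h = sgm q \<sigma> C (query t (sgm_state upd s t h)) D" for h
  have sets_A: "sets (?A t) = sets (outputs t)" for t
    using adaptive_sgm_in_prob_algebra by (auto simp: space_prob_algebra)
  have R: "?R t \<in> outputs t \<rightarrow>\<^sub>M subprob_algebra borel" for t
    using measurable_compose[OF sgm_state_measurable return_measurable] by blast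
  have upd: "(\<lambda>(h, y). h(t := y)) \<in> outputs t \<Otimes>\<^sub>M borel \<rightarrow>\<^sub>M outputs (Suc t)"
    unfolding lessThan_Suc by measurable
  have upd': "(\<lambda>y. return (outputs (Suc t)) (h(t := y))) \<in> borel \<rightarrow>\<^sub>M subprob_algebra (outputs (Suc t))"
    if "h \<in> space (outputs t)" for h
    using measurable_compose[OF measurable_compose[OF measurable_Pair1'[OF that] upd] return_measurable]
    by simp
  have "process (Suc t) s = ?A t \<bind> ?R t \<bind> step t"
    using Suc by (simp only: process_Suc)
  also have "\<dots> = ?A t \<bind> (\<lambda>h. step t (sgm_state upd s t h))"
    using R by (simp add: bind_assoc[OF _ measurable_prob_algebraD[OF step_measurable]]
        measurable_cong_sets[OF sets_A refl]
        bind_return[OF measurable_prob_algebraD[OF step_measurable]])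
  also have "\<dots> = ?A t \<bind> (\<lambda>h. K h \<bind> (\<lambda>y. return (outputs (Suc t)) (h(t := y))) \<bind> ?R (Suc t))"
  proof (rule bind_cong[OF refl])
    fix h assume "h \<in> space (?A t)"
    then have h: "h \<in> space (outputs t)"
      using sets_eq_imp_space_eq[OF sets_A] by simp
    have "sets (K h) = sets borel"
      unfolding K_def using finite_data noise_pos by (rule sets_sgm)
    note K = measurable_cong_sets[OF this refl]
    have "h(t := y) \<in> space (outputs (Suc t))" for y
      using measurable_space[OF upd, of "(h, y)"] h by (simp add: space_pair_measure)
    \<comment> \<open>The replay reads the new entry \<open>y\<close> only in its last update; the
      earlier state is untouched by \<open>h(t := y)\<close>.\<close>
    then have "return (outputs (Suc t)) (h(t := y)) \<bind> ?R (Suc t) = return borel (upd t (sgm_state upd s t h) y)" for y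
      by (subst bind_return[OF R]) (simp_all add: sgm_state_fun_upd)
    moreover have "(\<lambda>y. return (outputs (Suc t)) (h(t := y))) \<in> K h \<rightarrow>\<^sub>M subprob_algebra (outputs (Suc t))"
      using upd'[OF h] by (simp only: K)
    ultimately show "step t (sgm_state upd s t h) =
        K h \<bind> (\<lambda>y. return (outputs (Suc t)) (h(t := y))) \<bind> ?R (Suc t)"
      by (simp only: bind_assoc[OF _ R] step_def K_def)
  qed
  \<comment> \<open>Regrouping isolates the kernel that appends one output, which is the recursion
    step of \<open>adaptive_sgm\<close>.\<close>
  also have "\<dots> = ?A t \<bind> (\<lambda>h. K h \<bind> (\<lambda>y. return (outputs (Suc t)) (h(t := y)))) \<bind> ?R (Suc t)"
  proof (rule bind_assoc[OF _ R, symmetric])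
    have "(\<lambda>(h, y). return (outputs (Suc t)) (h(t := y))) \<in> outputs t \<Otimes>\<^sub>M borel \<rightarrow>\<^sub>M prob_algebra (outputs (Suc t))"
      using measurable_compose[OF upd measurable_return_prob_space] by (simp add: case_prod_beta')
    moreover have "K \<in> outputs t \<rightarrow>\<^sub>M prob_algebra borel"
      unfolding K_def[abs_def] using measurable_compose[OF sgm_state_measurable sgm_query_measurable] by blast
    ultimately show "(\<lambda>h. K h \<bind> (\<lambda>y. return (outputs (Suc t)) (h(t := y)))) \<in> ?A t \<rightarrow>\<^sub>M subprob_algebra (outputs (Suc t))"
      unfolding measurable_cong_sets[OF sets_A refl]
      by (intro measurable_prob_algebraD measurable_bind_prob_space2)
  qed
  also have "\<dots> = ?A (Suc t) \<bind> ?R (Suc t)"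
    by (simp add: K_def)
  finally show ?case .
qed

end

text \<open>The machine on the full data set is used because admissibility ranges over all batches
  in \<open>{1..n}\<close>; sensitivity at every state gives sensitivity at every record.\<close>

lemma (in sgm_machine) admissible_queries_sgm_state:
  assumes "D = {1..n}" and "\<And>t s. sensitivity_le n C (query t s)"
  shows "admissible_queries n N (\<lambda>_. C) (\<lambda>t h. query t (sgm_state upd s t h))"
  unfolding admissible_queries_def
proof (intro allI impI conjI ballI)
  fix t B assume "B \<subseteq> {1..n}"
  then show "(\<lambda>h. query t (sgm_state upd s t h) B) \<in> borel_measurable (outputs t)"
    using measurable_compose[OF sgm_state_measurable query_measurable] assms(1) by blast
qed (rule assms(2))

text \<open>Binding with a deterministic kernel is the pushforward along \<open>g\<close>, so an
  output event has the probability of its preimage, to which the given guarantee applies.\<close>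

lemma differentially_private_postprocess:
  assumes dp: "differentially_private n M A \<epsilon> \<delta>"
    and g: "g \<in> M \<rightarrow>\<^sub>M N"
    and A': "\<And>D. D \<subseteq> {1..n} \<Longrightarrow> A' D = A D \<bind> (\<lambda>x. return N (g x))"
  shows "differentially_private n N A' \<epsilon> \<delta>"
proof -
  have A: "A D \<in> space (prob_algebra M)" if "D \<subseteq> {1..n}" for D
    using dp that by (simp add: differentially_private_def)
  then have sets: "sets (A D) = sets M" if "D \<subseteq> {1..n}" for D
    using that by (simp add: space_prob_algebra)
  have g': "g \<in> A D \<rightarrow>\<^sub>M N" if "D \<subseteq> {1..n}" for D
    using g by (simp add: measurable_cong_sets[OF sets[OF that] refl])
  have A'': "A' D = distr (A D) N g" if "D \<subseteq> {1..n}" for D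
  proof -
    \<comment> \<open>Nonemptiness excludes the degenerate value of bind on an empty space.\<close>
    have "space (A D) \<noteq> {}"
      using A[OF that] by (simp add: space_prob_algebra prob_space.not_empty)
    then show ?thesis
      using g' that by (simp add: A' bind_return_distr')
  qed
  have meas: "measure (A' D) K = measure (A D) (g -` K \<inter> space M)" if "D \<subseteq> {1..n}" "K \<in> sets N" for D K
    using that g' by (simp add: A'' measure_distr sets_eq_imp_space_eq[OF sets])
  show ?thesis
    unfolding differentially_private_def
  proof (intro conjI allI impI ballI)
    fix D assume D: "D \<subseteq> {1..n}"
    show "A' D \<in> space (prob_algebra N)"
      using A[OF D] g'[OF D] by (simp add: A''[OF D] space_prob_algebra prob_space.prob_space_distr)
  next
    fix D D' K assume D: "D \<subseteq> {1..n}" "D' \<subseteq> {1..n}" "adjacent D D'" and K: "K \<in> sets N"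
    show "measure (A' D) K \<le> exp \<epsilon> * measure (A' D') K + \<delta>"
      using dp D measurable_sets[OF g K] unfolding meas[OF D(1) K] meas[OF D(2) K]
      by (auto simp: differentially_private_def)
  qed
qed

section \<open>Gradients and clipping\<close>

text \<open>Derivatives are unique and inner products with all vectors determine a vector, so the
  definite description in \<open>grad\<close> is well defined.\<close>

lemma GDERIV_imp_grad_eq:
  assumes "GDERIV f x :> g"
  shows "grad f x = g"
  unfolding grad_def
proof (rule the_equality, rule assms)
  fix g' assume "GDERIV f x :> g'"
  then have "(\<lambda>h. h \<bullet> g') = (\<lambda>h. h \<bullet> g)"
    using assms unfolding gderiv_def by (rule has_derivative_unique)
  then show "g' = g"
    by (metis vector_eq_ldot)
qed

lemma differentiable_imp_GDERIV_grad:
  fixes f :: "real ^ 'd::finite \<Rightarrow> real"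
  assumes "f differentiable (at x)"
  shows "GDERIV f x :> grad f x"
proof -
  obtain f' where f': "(f has_derivative f') (at x)"
    using assms by (auto simp: differentiable_def)
  then have "linear f'"
    using has_derivative_linear by blast
  \<comment> \<open>The Riesz representative of a linear functional is its adjoint applied to
    1.\<close>
  then have "f' = (\<lambda>h. h \<bullet> adjoint f' 1)"
    using adjoint_works[of f' _ 1] by (simp add: fun_eq_iff)
  then have "GDERIV f x :> adjoint f' 1"
    using f' by (simp add: gderiv_def)
  then show ?thesis
    using GDERIV_imp_grad_eq by metis
qed

text \<open>Each partial derivative is a pointwise limit of difference quotients, which are Borel
  because differentiability implies continuity.\<close>

lemma borel_measurable_grad:
  fixes f :: "real ^ 'd::finite \<Rightarrow> real"
  assumes f: "\<And>x. f differentiable (at x)"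
  shows "grad f \<in> borel_measurable borel"
proof (rule borel_measurable_vec)
  fix a :: 'd
  define e :: "real ^ 'd" where "e = axis a 1"
  \<comment> \<open>A sequence of nonzero step sizes tending to 0, so that the limit is a countable
    one.\<close>
  define r where "r k = inverse (real (Suc k))" for k
  have "continuous_on UNIV f"
    using f by (auto intro!: continuous_at_imp_continuous_on differentiable_imp_continuous_within)
  then have [measurable]: "f \<in> borel_measurable borel"
    by (rule borel_measurable_continuous_onI)
  show "(\<lambda>x. grad f x $ a) \<in> borel_measurable borel"
  proof (rule borel_measurable_LIMSEQ_real)
    fix x :: "real ^ 'd"
    have "((\<lambda>s. f (x + s *\<^sub>R e)) has_derivative (\<lambda>s. (s *\<^sub>R e) \<bullet> grad f x)) (at 0)"
    proof (rule has_derivative_compose[where g = f, where f = "\<lambda>s. x + s *\<^sub>R e", where s = UNIV])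
      show "((\<lambda>s. x + s *\<^sub>R e) has_derivative (\<lambda>s. s *\<^sub>R e)) (at 0)"
        by (auto intro!: derivative_eq_intros)
      show "(f has_derivative (\<lambda>h. h \<bullet> grad f x)) (at (x + 0 *\<^sub>R e))"
        using differentiable_imp_GDERIV_grad[OF f, of x] by (simp add: gderiv_def)
    qed
    then have "((\<lambda>s. f (x + s *\<^sub>R e)) has_field_derivative (grad f x $ a)) (at 0)"
      by (simp add: has_field_derivative_def e_def inner_axis' mult_commute_abs)
    then have "((\<lambda>s. (f (x + s *\<^sub>R e) - f x) / s) \<longlongrightarrow> grad f x $ a) (at 0)"
      by (simp add: DERIV_def)
    moreover have "filterlim r (at 0) sequentially"
      unfolding r_def filterlim_at using LIMSEQ_inverse_real_of_nat by auto
    ultimately show "(\<lambda>k. (f (x + r k *\<^sub>R e) - f x) / r k) \<longlonglongrightarrow> grad f x $ a"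
      by (rule filterlim_compose)
  qed measurable
qed

text \<open>The chain rule for entrywise multiplication by \<open>m\<close>, a self-adjoint linear
  map, which therefore reappears in front of the gradient.\<close>

lemma grad_masked:
  fixes f :: "real ^ 'd::finite \<Rightarrow> real"
  assumes "f differentiable (at (w + m * v))"
  shows "grad (\<lambda>v. f (w + m * v)) v = m * grad f (w + m * v)"
proof (rule GDERIV_imp_grad_eq)
  have "(f has_derivative (\<lambda>h. h \<bullet> grad f (w + m * v))) (at (w + m * v))"
    using differentiable_imp_GDERIV_grad[OF assms] by (simp add: gderiv_def)
  moreover have "bounded_linear (\<lambda>v. m * v)"
    by (rule linear_conv_bounded_linear[THEN iffD1], rule linearI) (simp_all add: vec_eq_iff algebra_simps)
  then have "((\<lambda>v. w + m * v) has_derivative (\<lambda>h. m * h)) (at v)"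
    by (auto intro!: derivative_eq_intros bounded_linear_imp_has_derivative)
  ultimately have "((\<lambda>v. f (w + m * v)) has_derivative (\<lambda>h. (m * h) \<bullet> grad f (w + m * v))) (at v)"
    by (rule has_derivative_compose[rotated])
  moreover have "(m * h) \<bullet> g = h \<bullet> (m * g)" for h g :: "real ^ 'd"
    by (simp add: inner_vec_def mult.left_commute mult.assoc)
  ultimately show "GDERIV (\<lambda>v. f (w + m * v)) v :> m * grad f (w + m * v)"
    by (simp add: gderiv_def)
qed

text \<open>The clip factor is at least \<open>norm g / C\<close>, and \<open>h\<close> has the norm
  of \<open>g\<close>.\<close>

lemma norm_scale_clip_factor_le:
  assumes "0 < C" and "norm h = norm g"
  shows "norm (h /\<^sub>R clip_factor C g) \<le> C"
proof -
  have "norm g / C \<le> clip_factor C g" "1 \<le> clip_factor C g"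
    by (auto simp: clip_factor_def)
  then show ?thesis
    using assms by (simp add: divide_simps mult.commute)
qed

text \<open>Sums over adjacent batches differ, up to sign, by the single term of the added
  point.\<close>

lemma sensitivity_le_sum:
  fixes v :: "nat \<Rightarrow> real ^ 'd::finite"
  assumes "\<And>i. norm (v i) \<le> C"
  shows "sensitivity_le n C (\<lambda>B. \<Sum>i\<in>B. v i)"
proof -
  have "norm (sum v (insert x S) - sum v S) \<le> C" if "x \<notin> S" "S \<subseteq> {1..n}" for x S
  proof -
    have "finite S"
      using that by (auto intro: finite_subset)
    then show ?thesis
      using that assms by simp
  qed
  then show ?thesis
    unfolding sensitivity_le_def adjacent_def by (metis norm_minus_commute)
qed

text \<open>Summands \<open>h\<close> and clipping vectors \<open>g\<close> are separate so that
  gradients and their entrywise absolute values share one form of query.\<close>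

definition clipped_sum :: "real \<Rightarrow> (nat \<Rightarrow> real ^ 'd::finite) \<Rightarrow> (nat \<Rightarrow> real ^ 'd) \<Rightarrow> nat set \<Rightarrow> real ^ 'd" where
  "clipped_sum C h g B = (\<Sum>i\<in>B. h i /\<^sub>R clip_factor C (g i))"

lemma sensitivity_le_clipped_sum:
  assumes "0 < C" and "\<And>i. norm (h i) = norm (g i)"
  shows "sensitivity_le n C (clipped_sum C h g)"
  unfolding clipped_sum_def[abs_def] using assms
  by (intro sensitivity_le_sum norm_scale_clip_factor_le)

lemma borel_measurable_clipped_sum:
  assumes "\<And>i. i \<in> B \<Longrightarrow> (\<lambda>x. h x i) \<in> borel_measurable M"
    and "\<And>i. i \<in> B \<Longrightarrow> (\<lambda>x. g x i) \<in> borel_measurable M"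
  shows "(\<lambda>x. clipped_sum C (h x) (g x) B) \<in> borel_measurable M"
  unfolding clipped_sum_def clip_factor_def
  by (intro borel_measurable_sum borel_measurable_scaleR borel_measurable_inverse borel_measurable_max
      borel_measurable_const borel_measurable_divide borel_measurable_norm[THEN measurable_compose[rotated]] assms)

abbreviation clipped_grad_sum ::
  "real \<Rightarrow> (nat \<Rightarrow> real ^ 'd::finite \<Rightarrow> real) \<Rightarrow> real ^ 'd \<Rightarrow> nat set \<Rightarrow> real ^ 'd" where
  "clipped_grad_sum C l W \<equiv> clipped_sum C (\<lambda>i. grad (l i) W) (\<lambda>i. grad (l i) W)"

abbreviation clipped_abs_grad_sum ::
  "real \<Rightarrow> (nat \<Rightarrow> real ^ 'd::finite \<Rightarrow> real) \<Rightarrow> real ^ 'd \<Rightarrow> nat set \<Rightarrow> real ^ 'd" where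
  "clipped_abs_grad_sum C l W \<equiv>
     clipped_sum C (\<lambda>i. \<chi> a. \<bar>grad (l i) W $ a\<bar>) (\<lambda>i. grad (l i) W)"

definition sgd_update :: "nat \<Rightarrow> real \<Rightarrow> real \<Rightarrow> real ^ 'd::finite \<Rightarrow> real ^ 'd \<Rightarrow> real ^ 'd" where
  "sgd_update n q \<eta> W y = W - \<eta> *\<^sub>R ((1 / (q * real n)) *\<^sub>R y)"

section \<open>SPARTA as a state machine\<close>

text \<open>In \<open>dpsgd_step\<close> the noise is added to the clipped sum before scaling;
  scaling and descent are deterministic and hence belong to the update.\<close>

lemma dpsgd_eq_sgm_process:
  fixes l :: "nat \<Rightarrow> real ^ 'd::finite \<Rightarrow> real"
  assumes "0 < C * \<sigma>"
  shows "dpsgd n q \<sigma> C l \<eta> W0 t D =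
    sgm_process q \<sigma> C (\<lambda>_. clipped_grad_sum C l) (\<lambda>t. sgd_update n q (\<eta> t)) D t W0"
proof (induction t)
  case (Suc t)
  have "dpsgd_step n q \<sigma> C l D (\<eta> t) W =
      sgm q \<sigma> C (clipped_grad_sum C l W) D \<bind> (\<lambda>y. return borel (sgd_update n q (\<eta> t) W y))" for W
  proof -
    have "sgd_update n q (\<eta> t) W \<in> borel \<rightarrow>\<^sub>M borel"
      unfolding sgd_update_def[abs_def] by measurable
    from sgm_bind_return[OF assms this] show ?thesis
      by (simp add: dpsgd_step_def sgd_update_def clipped_sum_def Let_def)
  qed
  then show ?case
    by (simp add: Suc)
qed simp

text \<open>The weights stay fixed during the mask epoch, so they are a parameter of the query and
  the running total is the whole state.\<close>

lemma mask_scores_eq_sgm_process: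
  fixes L :: "nat \<Rightarrow> real ^ 'd::finite \<Rightarrow> real"
  assumes "0 < C * \<sigma>"
  shows "mask_scores q \<sigma> C L W t D =
    sgm_process q \<sigma> C (\<lambda>_ _. clipped_abs_grad_sum C L W) (\<lambda>_. (+)) D t 0"
proof (induction t)
  case (Suc t)
  have "sgm q \<sigma> C (clipped_abs_grad_sum C L W) D \<bind> (\<lambda>y. return borel (u + y)) =
      measure_pmf (poisson_sample q D) \<bind> (\<lambda>B. gaussian (C * \<sigma>) \<bind>
        (\<lambda>z. return borel (u + ((\<Sum>i\<in>B. (\<chi> a. \<bar>grad (L i) W $ a\<bar>) /\<^sub>R clip_factor C (grad (L i) W)) + z))))" for u
    by (subst sgm_bind_return[OF assms]) (simp_all add: clipped_sum_def)
  then show ?case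
    by (simp add: Suc)
qed simp

lemma measurable_group_scores: "group_scores G \<in> borel \<rightarrow>\<^sub>M borel"
proof (rule borel_measurable_vec)
  show "(\<lambda>u. group_scores G u $ j) \<in> borel_measurable borel" for j
    unfolding group_scores_def vec_lambda_beta by measurable
qed

lemma measurable_weight_mask: "weight_mask G \<in> borel \<rightarrow>\<^sub>M borel"
proof (rule borel_measurable_vec)
  show "(\<lambda>z. weight_mask G z $ i) \<in> borel_measurable borel" for i
    unfolding weight_mask_def vec_lambda_beta by measurable
qed

text \<open>Here \<open>mask\<close> stands for the whole map from scores to weight mask, and
  \<open>a\<close>, \<open>b\<close> are the numbers of steps of the first two phases.\<close>

locale sparta_setting =
  fixes n :: nat
    and q \<sigma> C :: real
    and L :: "nat \<Rightarrow> real ^ 'd::finite \<Rightarrow> real"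
    and \<eta>\<^sub>1 \<eta>\<^sub>3 :: "nat \<Rightarrow> real"
    and mask :: "real ^ 'd \<Rightarrow> real ^ 'd"
    and a b :: nat
  assumes sigma_pos: "0 < \<sigma>" and C_pos: "0 < C"
    and differentiable: "\<And>i W. i \<in> {1..n} \<Longrightarrow> L i differentiable (at W)"
    and mask_measurable: "mask \<in> borel_measurable borel"
begin

abbreviation masked_loss :: "real ^ 'd \<Rightarrow> real ^ 'd \<Rightarrow> nat \<Rightarrow> real ^ 'd \<Rightarrow> real" where
  "masked_loss w u i v \<equiv> L i (w + mask u * v)"

text \<open>The state holds old weights \<open>w\<close>, scores \<open>u\<close> and sparse weights
  \<open>v\<close>. The mask is recomputed from \<open>u\<close>, which no step of the third phase
  changes.\<close>

definition query :: "nat \<Rightarrow> (real ^ 'd) \<times> (real ^ 'd) \<times> (real ^ 'd) \<Rightarrow> nat set \<Rightarrow> real ^ 'd" where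
  "query t s = (case s of (w, u, v) \<Rightarrow>
     if t < a then clipped_grad_sum C L w
     else if t < a + b then clipped_abs_grad_sum C L w
     else clipped_grad_sum C (masked_loss w u) v)"

text \<open>The third phase restarts its clock: its learning rates are indexed from 0, as in a
  stand-alone run of \<open>dpsgd\<close>.\<close>

definition upd :: "nat \<Rightarrow> (real ^ 'd) \<times> (real ^ 'd) \<times> (real ^ 'd) \<Rightarrow> real ^ 'd \<Rightarrow>
    (real ^ 'd) \<times> (real ^ 'd) \<times> (real ^ 'd)" where
  "upd t s y = (case s of (w, u, v) \<Rightarrow>
     if t < a then (sgd_update n q (\<eta>\<^sub>1 t) w y, u, v)
     else if t < a + b then (w, u + y, v)
     else (w, u, sgd_update n q (\<eta>\<^sub>3 (t - (a + b))) v y))"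

definition result :: "(real ^ 'd) \<times> (real ^ 'd) \<times> (real ^ 'd) \<Rightarrow> (real ^ 'd) \<times> (real ^ 'd)" where
  "result s = (case s of (w, u, v) \<Rightarrow> (mask u, w + mask u * v))"

lemma noise_pos: "0 < C * \<sigma>"
  using sigma_pos C_pos by simp

text \<open>Summand and clipping vector coincide in the two descent phases; in mask selection they
  differ by entrywise absolute values, which leave the norm unchanged.\<close>

lemma sensitivity_query: "sensitivity_le n C (query t s)"
  using C_pos unfolding query_def
  by (auto split: prod.split intro!: sensitivity_le_clipped_sum simp: norm_vec_def)

lemma grad_measurable: "i \<in> {1..n} \<Longrightarrow> grad (L i) \<in> borel_measurable borel"
  using differentiable by (rule borel_measurable_grad)

lemma abs_grad_measurable:
  assumes "i \<in> {1..n}"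
  shows "(\<lambda>w. \<chi> a. \<bar>grad (L i) w $ a\<bar>) \<in> borel_measurable borel"
proof (rule borel_measurable_vec)
  fix a
  show "(\<lambda>w. (\<chi> a. \<bar>grad (L i) w $ a\<bar>) $ a) \<in> borel_measurable borel"
    using measurable_compose[OF grad_measurable[OF assms] borel_measurable_nth]
    by (simp only: vec_lambda_beta borel_measurable_abs)
qed

text \<open>The differentiated function itself varies with \<open>x\<close>, so
  \<open>borel_measurable_grad\<close> does not apply directly; \<open>grad_masked\<close> reduces
  the claim to the fixed map \<open>grad (L i)\<close>.\<close>

lemma masked_grad_measurable:
  assumes "i \<in> {1..n}" and w: "w \<in> borel_measurable M" and u: "u \<in> borel_measurable M"
    and v: "v \<in> borel_measurable M"
  shows "(\<lambda>x. grad (masked_loss (w x) (u x) i) (v x)) \<in> borel_measurable M"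
proof -
  have m: "(\<lambda>x. mask (u x)) \<in> borel_measurable M"
    using u mask_measurable by (rule measurable_compose)
  have "(\<lambda>x. w x + mask (u x) * v x) \<in> borel_measurable M"
    by (intro borel_measurable_add w borel_measurable_vec_mult m v)
  from measurable_compose[OF this grad_measurable[OF assms(1)]]
  have "(\<lambda>x. mask (u x) * grad (L i) (w x + mask (u x) * v x)) \<in> borel_measurable M"
    by (intro borel_measurable_vec_mult m)
  then show ?thesis
    using differentiable[OF assms(1)] by (simp add: grad_masked)
qed

lemma query_measurable:
  assumes "B \<subseteq> {1..n}"
  shows "(\<lambda>s. query t s B) \<in> borel_measurable borel"
proof -
  note fst = borel_measurable_fst and snd = borel_measurable_snd
  note w = fst and u = measurable_compose[OF snd fst] and v = measurable_compose[OF snd snd]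
  have "(\<lambda>s. clipped_grad_sum C L (fst s) B) \<in> borel_measurable borel"
    using assms by (intro borel_measurable_clipped_sum measurable_compose[OF w grad_measurable]) auto
  moreover have "(\<lambda>s. clipped_abs_grad_sum C L (fst s) B) \<in> borel_measurable borel"
    using assms by (intro borel_measurable_clipped_sum measurable_compose[OF w grad_measurable]
        measurable_compose[OF w abs_grad_measurable]) auto
  moreover have "(\<lambda>s. clipped_grad_sum C (masked_loss (fst s) (fst (snd s))) (snd (snd s)) B)
      \<in> borel_measurable borel"
    using assms by (intro borel_measurable_clipped_sum masked_grad_measurable w u v) auto
  ultimately show ?thesis
    unfolding query_def case_prod_beta' by (cases "t < a"; cases "t < a + b") simp_all
qed

lemma sgd_update_measurable:
  assumes [measurable]: "w \<in> borel_measurable M" "y \<in> borel_measurable M"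
  shows "(\<lambda>x. sgd_update n q r (w x) (y x)) \<in> borel_measurable M"
  unfolding sgd_update_def by measurable

lemma upd_measurable: "(\<lambda>(s, y). upd t s y) \<in> borel \<Otimes>\<^sub>M borel \<rightarrow>\<^sub>M borel"
proof -
  note y = measurable_snd[of borel borel]
    and w = measurable_compose[OF measurable_fst borel_measurable_fst]
    and u = measurable_compose[OF measurable_compose[OF measurable_fst borel_measurable_snd] borel_measurable_fst]
    and v = measurable_compose[OF measurable_compose[OF measurable_fst borel_measurable_snd] borel_measurable_snd]
  show ?thesis
    unfolding upd_def case_prod_beta'
    by (cases "t < a"; cases "t < a + b"; simp del: prod.collapse;
        intro borel_measurable_Pair sgd_update_measurable borel_measurable_add y w u v)
qed

lemma result_measurable: "result \<in> borel \<rightarrow>\<^sub>M borel"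
proof -
  note fst = borel_measurable_fst and snd = borel_measurable_snd
  note w = fst and u = measurable_compose[OF snd fst] and v = measurable_compose[OF snd snd]
  show ?thesis
    unfolding result_def[abs_def] case_prod_beta'
    by (intro borel_measurable_Pair borel_measurable_add borel_measurable_vec_mult
        measurable_compose[OF u mask_measurable] w v)
qed

lemma sgm_machine_sparta:
  assumes "D \<subseteq> {1..n}"
  shows "sgm_machine \<sigma> C D query upd"
proof
  show "finite D"
    using assms by (rule finite_subset) simp
  show "(\<lambda>s. query t s B) \<in> borel_measurable borel" if "B \<subseteq> D" for t B
    using that assms by (intro query_measurable) blast
qed (rule noise_pos upd_measurable)+

text \<open>The run splits into three phases by \<open>process_add\<close>. Each phase moves one
  coordinate of the state, so \<open>process_simulation\<close> identifies it with a stand-alone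
  algorithm embedded into the triple.\<close>

lemma sgm_process_eq_phases:
  assumes D: "D \<subseteq> {1..n}"
  shows "sgm_process q \<sigma> C query upd D (a + b + c) (w0, 0, 0) \<bind> (\<lambda>s. return borel (result s)) = do {
     w \<leftarrow> dpsgd n q \<sigma> C L \<eta>\<^sub>1 w0 a D;
     u \<leftarrow> mask_scores q \<sigma> C L w b D;
     v \<leftarrow> dpsgd n q \<sigma> C (masked_loss w u) \<eta>\<^sub>3 0 c D;
     return borel (mask u, w + mask u * v)
   }"
proof -
  have fin: "finite D"
    using D by (rule finite_subset) simp
  have update: "(\<lambda>(s, y). sgd_update n q r s y) \<in> borel \<Otimes>\<^sub>M borel \<rightarrow>\<^sub>M borel" for r
    unfolding case_prod_beta' by (intro sgd_update_measurable measurable_fst measurable_snd)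
  interpret M: sgm_machine q \<sigma> C D query upd
    using D by (rule sgm_machine_sparta)
  interpret P2: sgm_machine q \<sigma> C D "\<lambda>t. query (a + t)" "\<lambda>t. upd (a + t)"
    by unfold_locales (simp_all add: fin M.noise_pos M.query_measurable M.upd_measurable)
  interpret P3: sgm_machine q \<sigma> C D "\<lambda>t. query (a + b + t)" "\<lambda>t. upd (a + b + t)"
    by unfold_locales (simp_all add: fin M.noise_pos M.query_measurable M.upd_measurable)
  interpret S1: sgm_machine q \<sigma> C D "\<lambda>_. clipped_grad_sum C L" "\<lambda>t. sgd_update n q (\<eta>\<^sub>1 t)"
    using D by unfold_locales (auto intro!: fin noise_pos update borel_measurable_clipped_sum grad_measurable)
  have S2: "sgm_machine \<sigma> C D (\<lambda>_ _. clipped_abs_grad_sum C L w) (\<lambda>_. (+))" for w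
    by unfold_locales (auto intro!: fin noise_pos)
  have S3: "sgm_machine \<sigma> C D (\<lambda>_. clipped_grad_sum C (masked_loss w u)) (\<lambda>t. sgd_update n q (\<eta>\<^sub>3 t))" for w u
    using D by unfold_locales
      (auto intro!: fin noise_pos update borel_measurable_clipped_sum masked_grad_measurable)

  have pair1: "(\<lambda>w. (w, 0, 0)) \<in> borel \<rightarrow>\<^sub>M (borel :: ((real ^ 'd) \<times> (real ^ 'd) \<times> (real ^ 'd)) measure)"
    and pair2: "(\<lambda>u. (w, u, 0)) \<in> borel \<rightarrow>\<^sub>M (borel :: ((real ^ 'd) \<times> (real ^ 'd) \<times> (real ^ 'd)) measure)"
    and pair3: "(\<lambda>v. (w, u, v)) \<in> borel \<rightarrow>\<^sub>M (borel :: ((real ^ 'd) \<times> (real ^ 'd) \<times> (real ^ 'd)) measure)"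
    for w u
    by (intro borel_measurable_Pair measurable_const measurable_ident; simp)+

  \<comment> \<open>The first phase moves only \<open>w\<close>; the other coordinates keep the
    value 0 from which \<open>mask_scores\<close> and the masked \<open>dpsgd\<close> start.\<close>
  have phase1: "M.process a (w0, 0, 0) = S1.process a w0 \<bind> (\<lambda>w. return borel (w, 0, 0))"
    by (rule S1.process_simulation[where e = "\<lambda>w. (w, 0, 0)", OF M.sgm_machine_axioms pair1])
      (simp_all add: query_def upd_def)
  \<comment> \<open>The old weights are frozen from here on, so for each \<open>w\<close> this phase
    is a machine on the scores alone.\<close>
  have phase2: "P2.process b (w, 0, 0) = mask_scores q \<sigma> C L w b D \<bind> (\<lambda>u. return borel (w, u, 0))" for w
    unfolding mask_scores_eq_sgm_process[OF noise_pos]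
    by (rule sgm_machine.process_simulation[where e = "\<lambda>u. (w, u, 0)", OF S2 P2.sgm_machine_axioms pair2])
      (simp_all add: query_def upd_def)
  have phase3: "P3.process c (w, u, 0) =
      dpsgd n q \<sigma> C (masked_loss w u) \<eta>\<^sub>3 0 c D \<bind> (\<lambda>v. return borel (w, u, v))" for w u
    unfolding dpsgd_eq_sgm_process[OF noise_pos]
    by (rule sgm_machine.process_simulation[where e = "\<lambda>v. (w, u, v)", OF S3 P3.sgm_machine_axioms pair3])
      (simp_all add: query_def upd_def)

  have S1_meas: "measurable (S1.process a w0) N = measurable borel N" for N :: "'x measure"
    by simp
  have S2_meas: "measurable (mask_scores q \<sigma> C L w b D) N = measurable borel N" for w and N :: "'x measure"
    unfolding mask_scores_eq_sgm_process[OF noise_pos] by (rule sgm_machine.measurable_process_iff[OF S2])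
  have S3_meas: "measurable (dpsgd n q \<sigma> C (masked_loss w u) \<eta>\<^sub>3 0 c D) N = measurable borel N"
    for w u and N :: "'x measure"
    unfolding dpsgd_eq_sgm_process[OF noise_pos] by (rule sgm_machine.measurable_process_iff[OF S3])

  let ?R = "\<lambda>s. return borel (result s)"
  have R: "?R \<in> borel \<rightarrow>\<^sub>M subprob_algebra borel"
    using measurable_compose[OF result_measurable return_measurable] .
  note K2 = measurable_prob_algebraD[OF P2.process_measurable, of b]
  note K3 = measurable_prob_algebraD[OF P3.process_measurable, of c]
  \<comment> \<open>Applying \<open>bind_return_bind\<close> requires the whole continuation to be a
    measurable kernel, so the remaining phases are composed from the back.\<close>
  have K3R: "(\<lambda>s. P3.process c s \<bind> ?R) \<in> borel \<rightarrow>\<^sub>M subprob_algebra borel"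
    using K3 R by (rule measurable_bind2)
  have K23R: "(\<lambda>s. P2.process b s \<bind> (\<lambda>s. P3.process c s \<bind> ?R)) \<in> borel \<rightarrow>\<^sub>M subprob_algebra borel"
    using K2 K3R by (rule measurable_bind2)

  have last: "P3.process c (w, u, 0) \<bind> ?R =
      dpsgd n q \<sigma> C (masked_loss w u) \<eta>\<^sub>3 0 c D \<bind> (\<lambda>v. return borel (mask u, w + mask u * v))" for w u
    unfolding phase3 by (subst bind_return_bind[OF _ R]) (simp_all add: S3_meas pair3 result_def)
  have middle: "P2.process b (w, 0, 0) \<bind> (\<lambda>s. P3.process c s \<bind> ?R) =
      mask_scores q \<sigma> C L w b D \<bind> (\<lambda>u. P3.process c (w, u, 0) \<bind> ?R)" for w
    unfolding phase2 by (subst bind_return_bind[OF _ K3R]) (simp_all add: S2_meas pair2)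

  \<comment> \<open>After two splits, reassociating to the right binds each phase to its
    continuation.\<close>
  have "M.process (a + b + c) (w0, 0, 0) \<bind> ?R =
      M.process a (w0, 0, 0) \<bind> P2.process b \<bind> P3.process c \<bind> ?R"
    unfolding M.process_add[of "a + b"] M.process_add[of a] ..
  also have "\<dots> = M.process a (w0, 0, 0) \<bind> P2.process b \<bind> (\<lambda>s. P3.process c s \<bind> ?R)"
    by (rule bind_assoc[OF _ R]) (simp add: K3 
        measurable_cong_sets[OF sets_bind'[OF M.process_in_prob_algebra P2.process_measurable] refl])
  also have "\<dots> = M.process a (w0, 0, 0) \<bind> (\<lambda>s. P2.process b s \<bind> (\<lambda>s. P3.process c s \<bind> ?R))"
    using K2 by (intro bind_assoc[OF _ K3R]) simp
  also have "\<dots> = S1.process a w0 \<bind> (\<lambda>w. P2.process b (w, 0, 0) \<bind> (\<lambda>s. P3.process c s \<bind> ?R))"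
    unfolding phase1 by (rule bind_return_bind[OF _ K23R]) (simp add: pair1)
  finally show ?thesis
    unfolding middle last dpsgd_eq_sgm_process[OF noise_pos, of n q L \<eta>\<^sub>1, symmetric] .
qed

end

section \<open>Transfer of the accountant's guarantee to SPARTA\<close>

theorem proposition4p2:
  fixes n Tb T0 T k :: nat
    and q \<sigma> C :: real
    and L :: "nat \<Rightarrow> real ^ 'd::finite \<Rightarrow> real"
    and \<eta>\<^sub>1 \<eta>\<^sub>3 :: "nat \<Rightarrow> real"
    and G :: "'p::finite \<Rightarrow> 'd set"
    and top_k :: "real ^ 'p \<Rightarrow> real ^ 'p"
    and W0 :: "real ^ 'd"
    and acc :: "real \<Rightarrow> real \<Rightarrow> nat \<Rightarrow> (real \<times> real) set"
    and \<epsilon> \<delta> :: real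
  assumes "0 < q" and "q \<le> 1" and "0 < \<sigma>" and "0 < C"
    and "1 \<le> Tb" and "T0 + 1 \<le> T"
    and "\<And>i W. i \<in> {1..n} \<Longrightarrow> L i differentiable (at W)"
    and "\<And>t. 0 < \<eta>\<^sub>1 t" and "\<And>t. 0 < \<eta>\<^sub>3 t"
    and "partition_on UNIV (range G)" and "inj G"
    and "top_k_rule k top_k"
    and "sgm_accountant TYPE('d) n acc"
    and "(\<epsilon>, \<delta>) \<in> acc q \<sigma> (T * Tb)"
  shows "differentially_private n borel (sparta n q \<sigma> C L \<eta>\<^sub>1 \<eta>\<^sub>3 G top_k W0 Tb T0 T) \<epsilon> \<delta>"
proof -
  define mask where "mask u = weight_mask G (top_k (group_scores G u))" for u
  have mask: "mask \<in> borel_measurable borel"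
    unfolding mask_def[abs_def]
    using measurable_compose[OF measurable_compose[OF measurable_group_scores] measurable_weight_mask]
      \<open>top_k_rule k top_k\<close>
    by (auto simp: top_k_rule_def)
  interpret sparta_setting n q \<sigma> C L \<eta>\<^sub>1 \<eta>\<^sub>3 mask "T0 * Tb" Tb
    using assms mask by unfold_locales auto
  \<comment> \<open>\<open>T0 + 1 \<le> T\<close> makes the truncated subtraction exact, so the
    phases use exactly the certified number of steps.\<close>
  have steps: "T0 * Tb + Tb + (T - T0 - 1) * Tb = T * Tb"
  proof -
    have "T * Tb = (T0 + 1 + (T - T0 - 1)) * Tb"
      using \<open>T0 + 1 \<le> T\<close> by simp
    then show ?thesis
      by (simp add: algebra_simps)
  qed
  \<comment> \<open>The queries see the data only through the batch; earlier outputs enter through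
    the state replayed from the public start.\<close>
  let ?f = "\<lambda>t h. query t (sgm_state upd (W0, 0, 0) t h)"
  interpret full: sgm_machine q \<sigma> C "{1..n}" query upd
    by (rule sgm_machine_sparta) simp
  have "admissible_queries n (T * Tb) (\<lambda>_. C) ?f"
    using sensitivity_query by (intro full.admissible_queries_sgm_state) simp_all
  with assms have "differentially_private n (outputs (T * Tb)) (adaptive_sgm q \<sigma> (\<lambda>_. C) ?f (T * Tb)) \<epsilon> \<delta>"
    by (intro \<open>sgm_accountant TYPE('d) n acc\<close>[unfolded sgm_accountant_def, rule_format]) simp_all
  \<comment> \<open>The post-processing map is the same for every dataset.\<close>
  moreover have "(\<lambda>h. result (sgm_state upd (W0, 0, 0) (T * Tb) h)) \<in> outputs (T * Tb) \<rightarrow>\<^sub>M borel"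
    using measurable_compose[OF full.sgm_state_measurable result_measurable] by blast
  moreover have "sparta n q \<sigma> C L \<eta>\<^sub>1 \<eta>\<^sub>3 G top_k W0 Tb T0 T D =
      adaptive_sgm q \<sigma> (\<lambda>_. C) ?f (T * Tb) D \<bind>
        (\<lambda>h. return borel (result (sgm_state upd (W0, 0, 0) (T * Tb) h)))"
    if D: "D \<subseteq> {1..n}" for D
  proof -
    interpret M: sgm_machine q \<sigma> C D query upd
      using D by (rule sgm_machine_sparta)
    let ?A = "adaptive_sgm q \<sigma> (\<lambda>_. C) ?f (T * Tb) D"
    have "sparta n q \<sigma> C L \<eta>\<^sub>1 \<eta>\<^sub>3 G top_k W0 Tb T0 T D =
        M.process (T * Tb) (W0, 0, 0) \<bind> (\<lambda>s. return borel (result s))"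
      using sgm_process_eq_phases[OF D, of "(T - T0 - 1) * Tb" W0]
      unfolding steps sparta_def Let_def mask_def by simp
    also have "\<dots> = ?A \<bind> (\<lambda>h. return borel (result (sgm_state upd (W0, 0, 0) (T * Tb) h)))"
    proof -
      have sets: "sets ?A = sets (outputs (T * Tb))"
        using M.adaptive_sgm_in_prob_algebra by (simp add: space_prob_algebra)
      have "sgm_state upd (W0, 0, 0) (T * Tb) \<in> ?A \<rightarrow>\<^sub>M borel"
        unfolding measurable_cong_sets[OF sets refl] by (rule M.sgm_state_measurable) simp
      from bind_return_bind[OF this measurable_compose[OF result_measurable return_measurable]]
      show ?thesis
        unfolding M.process_eq_adaptive_sgm .
    qed
    finally show ?thesis .
  qed
  ultimately show ?thesis
    by (rule differentially_private_postprocess)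
qed

end
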